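(* Let $(X,d_X)$ be a compact, connected and locally path-connected metric space, $p\ge1$, $\theta$ an admissible pseudo-metric on $X$, $V\subseteq X$ a finite $\delta$-covering of $(X,d_X)$ with $\delta>0$, $X_n=\{x_1,\dots,x_n\}\subseteq X$ a dataset, and $\mathcal{V}_n=(V,d_V,\omega_n)$ an associated combinatorial $\delta$-approximation with graph $G=(V,E)$. Let $\sigma\colon V\to\mathbb{R}$ be the $p$-deviation function of $\mathcal{V}_n$, and for $\varepsilon>0$ let $\tau_\varepsilon(v)=\varepsilon\lfloor\sigma(v)/\varepsilon\rfloor$. Let $\mathcal{F}_p(\mathcal{V}_n)$ be the combinatorial functional merge tree of $(G,\omega_n)$ constructed from $\sigma$, and $\mathcal{F}_{p,\varepsilon}(\mathcal{V}_n)$ the one constructed from $\tau_\varepsilon$. Then, for any $\varepsilon>0$, $$D_{KS,p}\big(\mathcal{F}_p(\mathcal{V}_n),\mathcal{F}_{p,\varepsilon}(\mathcal{V}_n)\big)\le\varepsilon.$$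
   Context: $\vee$ denotes max. $\theta$ is admissible if $\theta\le L\,d_X$ for some $L>0$. $V=\{v_1,\dots,v_m\}\subseteq X$ is a $\delta$-covering if every $x\in X$ satisfies $d_X(x,v_i)\le\delta$ for some $i$. Combinatorial $\delta$-approximation: $G=(V,E)$ is the simple graph with $\{v_i,v_j\}\in E$ iff $i\ne j$ and $d_X(v_i,v_j)\le3\delta$; $d_V$ is the restriction of $d_X$ to $V$. Choose $\phi\colon X_n\to V$ with $d_X(x_i,\phi(x_i))\le\delta$ for all $i$ (arbitrary choice), and let $\omega_n(v)=|\phi^{-1}(v)|/n$. Then $\mathcal{V}_n=(V,d_V,\omega_n)$ and its $p$-deviation function is $\sigma(v)=\big(\sum_{v'\in V}\theta^p(v,v')\,\omega_n(v')\big)^{1/p}$. Combinatorial functional merge tree of $(G,\omega_n)$ constructed from a function $g\colon V\to[0,\infty)$: let $G_t$ be the subgraph of $G$ induced by $\{v:g(v)\le t\}$. Set $v\sim w$ iff there is $t\ge0$ with $g(v)=g(w)=t$ and $v,w$ in the same connected component of $G_t$; $W=V/\sim$, quotient map $\alpha$, induced function $\kappa$ with $g=\kappa\circ\alpha$. With $C_v$ the component of $G_{g(v)}$ containing $v$, put $[v]\preceq[w]$ iff $C_v\subseteq C_w$, let $\Lambda[v,w]$ be the set of $[z]$ with $[v]\preceq[z]$ and $[w]\preceq[z]$, and let $d([v],[w])=\inf_{[z]\in\Lambda[v,w]}(g(z)-g(v))\vee(g(z)-g(w))$. The functional merge tree is $(W,d,\alpha_\sharp\omega_n,\kappa)$.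 Functional Kantorovich–Sturm distance: for (pseudo) metric measure spaces with functions $\mathcal{F}=(Z,d,\mu,f)$, $\mathcal{F}'=(Z',d',\mu',f')$, let $A,A'$ be the supports of $\mu,\mu'$; $M(\mathcal{Z},\mathcal{Z}')$ is the set of (pseudo) metrics $\delta'$ on $Z\sqcup Z'$ with $\delta'|_{A\times A}=d|_{A\times A}$ and $\delta'|_{A'\times A'}=d'|_{A'\times A'}$; $C(\mu,\mu')$ is the set of Borel probability measures on $Z\times Z'$ with marginals $\mu,\mu'$. Then $$D_{KS,p}(\mathcal{F},\mathcal{F}')=\inf_{h\in C(\mu,\mu'),\,\delta'\in M(\mathcal{Z},\mathcal{Z}')}\Big(\int\delta'^p\,dh\Big)^{1/p}\vee\Big(\int|f(z)-f'(z')|^p\,dh\Big)^{1/p}.$$ *)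

theory Defs
  imports "HOL-Probability.Probability"
begin

definition pseudo_metric_on :: "'z set \<Rightarrow> ('z \<Rightarrow> 'z \<Rightarrow> real) \<Rightarrow> bool" where
  "pseudo_metric_on Z d \<longleftrightarrow>
     (\<forall>x\<in>Z. \<forall>y\<in>Z. 0 \<le> d x y) \<and>
     (\<forall>x\<in>Z. d x x = 0) \<and>
     (\<forall>x\<in>Z. \<forall>y\<in>Z. d x y = d y x) \<and>
     (\<forall>x\<in>Z. \<forall>y\<in>Z. \<forall>z\<in>Z. d x z \<le> d x y + d y z)"

definition admissible :: "'a set \<Rightarrow> ('a \<Rightarrow> 'a \<Rightarrow> real) \<Rightarrow> ('a \<Rightarrow> 'a \<Rightarrow> real) \<Rightarrow> bool" where
  "admissible X dX \<theta> \<longleftrightarrow> (\<exists>L>0. \<forall>x\<in>X. \<forall>y\<in>X. \<theta> x y \<le> L * dX x y)"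

definition pm_open :: "'z set \<Rightarrow> ('z \<Rightarrow> 'z \<Rightarrow> real) \<Rightarrow> 'z set \<Rightarrow> bool" where
  "pm_open Z d U \<longleftrightarrow> U \<subseteq> Z \<and> (\<forall>x\<in>U. \<exists>r>0. {y \<in> Z. d x y < r} \<subseteq> U)"

definition pm_borel :: "'z set \<Rightarrow> ('z \<Rightarrow> 'z \<Rightarrow> real) \<Rightarrow> 'z measure" where
  "pm_borel Z d = sigma Z {U. pm_open Z d U}"

record 'z functional_mm_space =
  points :: "'z set"
  pdist :: "'z \<Rightarrow> 'z \<Rightarrow> real"
  mass :: "'z measure"
  func :: "'z \<Rightarrow> real"

definition mm_support :: "'z functional_mm_space \<Rightarrow> 'z set" where
  "mm_support F =
     {z \<in> points F. \<forall>U. pm_open (points F) (pdist F) U \<and> z \<in> U \<longrightarrow> 0 < emeasure (mass F) U}"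

(* The product topology on Z x Z' is the one of the pseudo-metric max d d'. *)
definition couplings ::
  "'z functional_mm_space \<Rightarrow> 'w functional_mm_space \<Rightarrow> ('z \<times> 'w) measure set" where
  "couplings F F' =
     {h. prob_space h \<and>
         space h = points F \<times> points F' \<and>
         sets h = sets (pm_borel (points F \<times> points F')
                    (\<lambda>a b. max (pdist F (fst a) (fst b)) (pdist F' (snd a) (snd b)))) \<and>
         distr h (pm_borel (points F) (pdist F)) fst = mass F \<and>
         distr h (pm_borel (points F') (pdist F')) snd = mass F'}"

definition metric_couplings ::
  "'z functional_mm_space \<Rightarrow> 'w functional_mm_space \<Rightarrow> ('z + 'w \<Rightarrow> 'z + 'w \<Rightarrow> real) set" where
  "metric_couplings F F' =
     {D. pseudo_metric_on (points F <+> points F') D \<and>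
         (\<forall>a\<in>mm_support F. \<forall>b\<in>mm_support F. D (Inl a) (Inl b) = pdist F a b) \<and>
         (\<forall>a\<in>mm_support F'. \<forall>b\<in>mm_support F'. D (Inr a) (Inr b) = pdist F' a b)}"

definition ennreal_root :: "real \<Rightarrow> ennreal \<Rightarrow> ennreal" where
  "ennreal_root p x = (if x = \<top> then \<top> else ennreal (enn2real x powr (1 / p)))"

(* The integrals are taken in [0, \<infinity>], so a pair with a divergent integral has cost \<infinity>
   (a Bochner integral would silently be 0 there). *)
definition KS_dist ::
  "real \<Rightarrow> 'z functional_mm_space \<Rightarrow> 'w functional_mm_space \<Rightarrow> ennreal" where
  "KS_dist p F F' =
     (INF (h, D) \<in> couplings F F' \<times> metric_couplings F F'.
        max (ennreal_root p (\<integral>\<^sup>+ z. ennreal (D (Inl (fst z)) (Inr (snd z)) powr p) \<partial>h))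
            (ennreal_root p (\<integral>\<^sup>+ z. ennreal (\<bar>func F (fst z) - func F' (snd z)\<bar> powr p) \<partial>h)))"

definition is_covering :: "'a set \<Rightarrow> ('a \<Rightarrow> 'a \<Rightarrow> real) \<Rightarrow> real \<Rightarrow> 'a set \<Rightarrow> bool" where
  "is_covering X dX \<delta> V \<longleftrightarrow> V \<subseteq> X \<and> (\<forall>x\<in>X. \<exists>v\<in>V. dX x v \<le> \<delta>)"

definition approx_edges :: "('a \<Rightarrow> 'a \<Rightarrow> real) \<Rightarrow> real \<Rightarrow> 'a set \<Rightarrow> 'a set set" where
  "approx_edges dX \<delta> V = {{v, w} | v w. v \<in> V \<and> w \<in> V \<and> v \<noteq> w \<and> dX v w \<le> 3 * \<delta>}"

(* Data points are counted by index, so that repeated data points count with multiplicity. *)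
definition approx_weight :: "nat \<Rightarrow> (nat \<Rightarrow> 'a) \<Rightarrow> ('a \<Rightarrow> 'a) \<Rightarrow> 'a \<Rightarrow> real" where
  "approx_weight n x \<phi> v = real (card {i \<in> {1..n}. \<phi> (x i) = v}) / real n"

definition deviation ::
  "real \<Rightarrow> ('a \<Rightarrow> 'a \<Rightarrow> real) \<Rightarrow> 'a set \<Rightarrow> ('a \<Rightarrow> real) \<Rightarrow> 'a \<Rightarrow> real" where
  "deviation p \<theta> V \<omega> v = (\<Sum>v'\<in>V. \<theta> v v' powr p * \<omega> v') powr (1 / p)"

definition quantize :: "real \<Rightarrow> ('a \<Rightarrow> real) \<Rightarrow> 'a \<Rightarrow> real" where
  "quantize \<epsilon> g v = \<epsilon> * real_of_int \<lfloor>g v / \<epsilon>\<rfloor>"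

context
  fixes V :: "'a set" and E :: "'a set set" and g :: "'a \<Rightarrow> real"
begin

definition sublevel :: "real \<Rightarrow> 'a set" where
  "sublevel t = {v \<in> V. g v \<le> t}"

definition sublevel_component :: "real \<Rightarrow> 'a \<Rightarrow> 'a set" where
  "sublevel_component t v =
     {w \<in> sublevel t.
        (v, w) \<in> {(a, b). a \<in> sublevel t \<and> b \<in> sublevel t \<and> {a, b} \<in> E}\<^sup>*}"

definition tree_rel :: "('a \<times> 'a) set" where
  "tree_rel =
     {(v, w). v \<in> V \<and> w \<in> V \<and>
        (\<exists>t\<ge>0. g v = t \<and> g w = t \<and> w \<in> sublevel_component t v)}"

definition tree_points :: "'a set set" where
  "tree_points = V // tree_rel"

definition tree_quot :: "'a \<Rightarrow> 'a set" where
  "tree_quot v = tree_rel `` {v}"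

(* g is constant on classes, so this is the function with g = tree_fun o tree_quot on V. *)
definition tree_fun :: "'a set \<Rightarrow> real" where
  "tree_fun c = the_elem (g ` c)"

definition tree_le :: "'a set \<Rightarrow> 'a set \<Rightarrow> bool" where
  "tree_le c c' \<longleftrightarrow>
     (\<exists>v\<in>V. \<exists>w\<in>V. c = tree_quot v \<and> c' = tree_quot w \<and>
        sublevel_component (g v) v \<subseteq> sublevel_component (g w) w)"

definition tree_upper :: "'a set \<Rightarrow> 'a set \<Rightarrow> 'a set set" where
  "tree_upper c c' = {z \<in> tree_points. tree_le c z \<and> tree_le c' z}"

(* If (V, E) is connected the infimum is over a nonempty set of nonnegative numbers;
   otherwise it may be over the empty set, where its value has no meaning. *)
definition tree_dist :: "'a set \<Rightarrow> 'a set \<Rightarrow> real" where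
  "tree_dist c c' =
     (INF z \<in> tree_upper c c'. max (tree_fun z - tree_fun c) (tree_fun z - tree_fun c'))"

(* V is finite and metric, so its Borel sets are all subsets, as in point_measure. *)
definition merge_tree :: "('a \<Rightarrow> real) \<Rightarrow> 'a set functional_mm_space" where
  "merge_tree \<omega> =
     \<lparr> points = tree_points,
       pdist = tree_dist,
       mass = distr (point_measure V (\<lambda>v. ennreal (\<omega> v))) (pm_borel tree_points tree_dist) tree_quot,
       func = tree_fun \<rparr>"

end

end

theory Submission
  imports Defs
begin

text \<open>
  In the merge tree of \<open>g\<close>, the distance between the classes of \<open>v\<close> and \<open>w\<close> is
  \<open>m(v, w) - min (g v) (g w)\<close>, where \<open>m(v, w)\<close> is the least level at which \<open>v\<close> and \<open>w\<close> lie in the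
  same component of the sublevel graph. Both terms move by at most \<open>\<epsilon>\<close> when \<open>g\<close> moves by at most
  \<open>\<epsilon>\<close>, so the correspondence \<open>[v] \<leftrightarrow> [v]'\<close> between the two trees has distortion at most \<open>2\<epsilon>\<close>. Hence
  the trees can be glued along it with matched points at distance \<open>\<epsilon>\<close>, and the push-forward of \<open>\<omega>\<close>
  to the matched pairs is a coupling of cost at most \<open>\<epsilon>\<close>. Connectedness of \<open>X\<close> serves to make the
  graph connected, so that \<open>m\<close> is finite.
\<close>

lemma pseudo_metric_onD:
  assumes "pseudo_metric_on Z d"
  shows "\<And>x y. x \<in> Z \<Longrightarrow> y \<in> Z \<Longrightarrow> 0 \<le> d x y"
    and "\<And>x. x \<in> Z \<Longrightarrow> d x x = 0"
    and "\<And>x y. x \<in> Z \<Longrightarrow> y \<in> Z \<Longrightarrow> d x y = d y x"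
    and "\<And>x y z. x \<in> Z \<Longrightarrow> y \<in> Z \<Longrightarrow> z \<in> Z \<Longrightarrow> d x z \<le> d x y + d y z"
  using assms unfolding pseudo_metric_on_def by blast+

subsection \<open>Gluing two pseudo-metrics along a correspondence\<close>

text \<open>The shortest route from \<open>a\<close> to \<open>b\<close> that crosses once, along a
  bridge of length \<open>c\<close> from \<open>f i\<close> to \<open>f' i\<close>. With
  \<open>I\<close> finite, the infimum usual in such gluings is a minimum, attained at some
  bridge.\<close>

definition cross_dist ::
  "'i set \<Rightarrow> ('i \<Rightarrow> 'z) \<Rightarrow> ('i \<Rightarrow> 'w) \<Rightarrow> ('z \<Rightarrow> 'z \<Rightarrow> real) \<Rightarrow> ('w \<Rightarrow> 'w \<Rightarrow> real) \<Rightarrow> real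
    \<Rightarrow> 'z \<Rightarrow> 'w \<Rightarrow> real" where
  "cross_dist I f f' d d' c a b = Min ((\<lambda>i. d a (f i) + c + d' (f' i) b) ` I)"

fun glue ::
  "('z \<Rightarrow> 'z \<Rightarrow> real) \<Rightarrow> ('w \<Rightarrow> 'w \<Rightarrow> real) \<Rightarrow> ('z \<Rightarrow> 'w \<Rightarrow> real) \<Rightarrow> 'z + 'w \<Rightarrow> 'z + 'w \<Rightarrow> real" where
  "glue d d' k (Inl a) (Inl b) = d a b"
| "glue d d' k (Inr a) (Inr b) = d' a b"
| "glue d d' k (Inl a) (Inr b) = k a b"
| "glue d d' k (Inr b) (Inl a) = k a b"

lemma cross_dist_le:
  assumes "finite I" "i \<in> I"
  shows "cross_dist I f f' d d' c a b \<le> d a (f i) + c + d' (f' i) b"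
  unfolding cross_dist_def using assms by (intro Min_le) auto

lemma cross_dist_attained:
  assumes "finite I" "I \<noteq> {}"
  obtains i where "i \<in> I" "cross_dist I f f' d d' c a b = d a (f i) + c + d' (f' i) b"
proof -
  have "cross_dist I f f' d d' c a b \<in> (\<lambda>i. d a (f i) + c + d' (f' i) b) ` I"
    unfolding cross_dist_def using assms by (intro Min_in) auto
  then show thesis using that by blast
qed

text \<open>A triangle with one crossing on each side reuses the optimal bridge of the right-hand
  side. A triangle whose detour crosses over and back pays \<open>2 * c\<close> for the two bridges,
  which is exactly the distortion allowed between them.\<close>

lemma pseudo_metric_on_glue:
  assumes dA: "pseudo_metric_on A d" and dB: "pseudo_metric_on B d'"
    and I: "finite I" "I \<noteq> {}" and f: "f ` I \<subseteq> A" and f': "f' ` I \<subseteq> B" and c: "0 \<le> c"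
    and distortion:
      "\<And>i j. i \<in> I \<Longrightarrow> j \<in> I \<Longrightarrow> \<bar>d (f i) (f j) - d' (f' i) (f' j)\<bar> \<le> 2 * c"
  shows "pseudo_metric_on (A <+> B) (glue d d' (cross_dist I f f' d d' c))"
proof -
  define k where "k = cross_dist I f f' d d' c"
  note A = pseudo_metric_onD[OF dA] and B = pseudo_metric_onD[OF dB]
  have fA: "f i \<in> A" and fB: "f' i \<in> B" if "i \<in> I" for i
    using f f' that by auto
  have le: "k a b \<le> d a (f i) + c + d' (f' i) b" if "i \<in> I" for a b i
    unfolding k_def using cross_dist_le I(1) that by metis
  have att: "\<exists>i\<in>I. k a b = d a (f i) + c + d' (f' i) b" for a b
    unfolding k_def using cross_dist_attained[OF I] by metis
  have nn: "0 \<le> k a b" if "a \<in> A" "b \<in> B" for a b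
    using att[of a b] A(1)[of a] B(1)[of _ b] fA fB that c by (metis add_nonneg_nonneg)
  have AAB: "k a b \<le> d a a' + k a' b" if "a \<in> A" "a' \<in> A" "b \<in> B" for a a' b
  proof -
    obtain i where i: "i \<in> I" "k a' b = d a' (f i) + c + d' (f' i) b" using att by blast
    show ?thesis using le[OF i(1), of a b] A(4)[of a a' "f i"] fA[OF i(1)] i(2) that by linarith
  qed
  have ABB: "k a b \<le> k a b' + d' b' b" if "a \<in> A" "b \<in> B" "b' \<in> B" for a b b'
  proof -
    obtain i where i: "i \<in> I" "k a b' = d a (f i) + c + d' (f' i) b'" using att by blast
    show ?thesis using le[OF i(1), of a b] B(4)[of "f' i" b' b] fB[OF i(1)] i(2) that by linarith
  qed
  \<comment> \<open>Follow \<open>a\<close>, \<open>f i\<close>, \<open>f j\<close>,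
    \<open>a'\<close>. The middle leg is at most \<open>d' (f' i) (f' j) + 2 * c\<close>, and
    \<open>d' (f' i) (f' j)\<close> is bounded by going through \<open>b\<close>.\<close>
  have ABA: "d a a' \<le> k a b + k a' b" if "a \<in> A" "a' \<in> A" "b \<in> B" for a a' b
  proof -
    obtain i where i: "i \<in> I" "k a b = d a (f i) + c + d' (f' i) b" using att by blast
    obtain j where j: "j \<in> I" "k a' b = d a' (f j) + c + d' (f' j) b" using att by blast
    show ?thesis
      using A(4)[of a "f i" a'] A(4)[of "f i" "f j" a'] A(3)[of "f j" a'] B(4)[of "f' i" b "f' j"]
        B(3)[of b "f' j"] distortion[OF i(1) j(1)] fA[OF i(1)] fA[OF j(1)] fB[OF i(1)] fB[OF j(1)]
        i(2) j(2) that by linarith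
  qed
  have BAB: "d' b b' \<le> k a b + k a b'" if "a \<in> A" "b \<in> B" "b' \<in> B" for a b b'
  proof -
    obtain i where i: "i \<in> I" "k a b = d a (f i) + c + d' (f' i) b" using att by blast
    obtain j where j: "j \<in> I" "k a b' = d a (f j) + c + d' (f' j) b'" using att by blast
    show ?thesis
      using B(4)[of b "f' i" b'] B(4)[of "f' i" "f' j" b'] B(3)[of b "f' i"] A(4)[of "f i" a "f j"]
        A(3)[of "f i" a] distortion[OF i(1) j(1)] fA[OF i(1)] fA[OF j(1)] fB[OF i(1)] fB[OF j(1)]
        i(2) j(2) that by linarith
  qed
  have sym: "glue d d' k x y = glue d d' k y x" if "x \<in> A <+> B" "y \<in> A <+> B" for x y
    using that by (auto intro: A(3) B(3))
  have tri: "glue d d' k x z \<le> glue d d' k x y + glue d d' k y z"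
    if "x \<in> A <+> B" "y \<in> A <+> B" "z \<in> A <+> B" for x y z
  proof -
    have BAA: "k a b \<le> k a' b + d a' a" if "a \<in> A" "a' \<in> A" "b \<in> B" for a a' b
      using AAB[OF that] A(3)[OF that(1,2)] by simp
    have BBA: "k a b \<le> d' b b' + k a b'" if "a \<in> A" "b \<in> B" "b' \<in> B" for a b b'
      using ABB[OF that] B(3)[OF that(2,3)] by simp
    show ?thesis using that by (auto intro: A(4) B(4) AAB ABB ABA BAB BAA BBA)
  qed
  show ?thesis
    unfolding k_def[symmetric] pseudo_metric_on_def
    using sym tri by (auto intro: nn A(1,2) B(1,2))
qed

subsection \<open>Merge trees of finite connected graphs\<close>

text \<open>A path of positive length starts inside the sublevel set and the empty path has
  \<open>w = v\<close>, so membership of \<open>w\<close> already forces that of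
  \<open>v\<close>.\<close>

lemma sublevel_component_iff:
  "w \<in> sublevel_component V E g t v \<longleftrightarrow> v \<in> sublevel V g t \<and> w \<in> sublevel V g t \<and>
     (v, w) \<in> {(a, b). a \<in> sublevel V g t \<and> b \<in> sublevel V g t \<and> {a, b} \<in> E}\<^sup>*"
  unfolding sublevel_component_def by (auto elim: converse_rtranclE)

lemma sublevel_component_refl:
  "v \<in> V \<Longrightarrow> g v \<le> t \<Longrightarrow> v \<in> sublevel_component V E g t v"
  by (simp add: sublevel_component_iff sublevel_def)

lemma sublevel_component_sym:
  assumes "w \<in> sublevel_component V E g t v"
  shows "v \<in> sublevel_component V E g t w"
proof -
  let ?R = "{(a, b). a \<in> sublevel V g t \<and> b \<in> sublevel V g t \<and> {a, b} \<in> E}"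
  have "sym (?R\<^sup>*)" by (intro sym_rtrancl symI) (auto simp: insert_commute)
  with assms show ?thesis unfolding sublevel_component_iff by (meson symD)
qed

lemma sublevel_component_trans:
  "w \<in> sublevel_component V E g t v \<Longrightarrow> u \<in> sublevel_component V E g t w \<Longrightarrow>
    u \<in> sublevel_component V E g t v"
  unfolding sublevel_component_iff by (meson rtrancl_trans)

text \<open>A path from \<open>v\<close> never leaves the component of \<open>v\<close>, so
  \<open>f\<close> has to be controlled only there. This permits a change of function as well as a
  lowering of the level to the maximum of \<open>g\<close> on the component.\<close>

lemma sublevel_component_subset:
  assumes "w \<in> sublevel_component V E g t v"
    and "\<And>u. u \<in> sublevel_component V E g t v \<Longrightarrow> f u \<le> s"
  shows "w \<in> sublevel_component V E f s v"
proof -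
  let ?R = "{(a, b). a \<in> sublevel V g t \<and> b \<in> sublevel V g t \<and> {a, b} \<in> E}"
  let ?Q = "{(a, b). a \<in> sublevel V f s \<and> b \<in> sublevel V f s \<and> {a, b} \<in> E}"
  have sub: "u \<in> sublevel V f s" if "u \<in> sublevel_component V E g t v" for u
    using that assms(2)[OF that] by (auto simp: sublevel_component_iff sublevel_def)
  have v: "v \<in> sublevel V g t" and "(v, w) \<in> ?R\<^sup>*"
    using assms(1) by (auto simp: sublevel_component_iff)
  \<comment> \<open>The induction also carries membership in the component, since the bound on
    \<open>f\<close> is available only there.\<close>
  from this(2) have "(v, w) \<in> ?Q\<^sup>* \<and> w \<in> sublevel_component V E g t v"
  proof (induction rule: rtrancl_induct)
    case base
    then show ?case using v by (simp add: sublevel_component_iff)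
  next
    case (step y z)
    then have z: "z \<in> sublevel_component V E g t v"
      by (auto simp: sublevel_component_iff intro: rtrancl_into_rtrancl)
    have "(y, z) \<in> ?Q" using sub[OF z] sub[of y] step by auto
    then show ?case using step.IH z by (meson rtrancl_into_rtrancl)
  qed
  moreover have "v \<in> sublevel_component V E g t v" using v by (simp add: sublevel_component_iff)
  ultimately show ?thesis using sub assms(1) by (simp add: sublevel_component_iff)
qed

lemma sublevel_component_mono:
  assumes "w \<in> sublevel_component V E g t v" "\<And>u. u \<in> V \<Longrightarrow> g u \<le> t \<Longrightarrow> f u \<le> s"
  shows "w \<in> sublevel_component V E f s v"
  using assms(1)
  by (rule sublevel_component_subset) (auto simp: sublevel_component_iff sublevel_def assms(2))

text \<open>\<open>nonneg\<close> takes care of the condition \<open>t \<ge> 0\<close> in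
  \<open>tree_rel\<close>: a vertex of negative value would not be related to itself.\<close>

locale merge_tree_graph =
  fixes V :: "'a set" and E :: "'a set set" and g :: "'a \<Rightarrow> real"
  assumes finite_V: "finite V"
    and connected: "\<And>v w. v \<in> V \<Longrightarrow> w \<in> V \<Longrightarrow>
      (v, w) \<in> {(a, b). a \<in> V \<and> b \<in> V \<and> {a, b} \<in> E}\<^sup>*"
    and nonneg: "\<And>v. v \<in> V \<Longrightarrow> 0 \<le> g v"
begin

abbreviation "component \<equiv> sublevel_component V E g"
abbreviation "quot \<equiv> tree_quot V E g"

lemma component_mono: "w \<in> component s v \<Longrightarrow> s \<le> t \<Longrightarrow> w \<in> component t v"
  by (erule sublevel_component_mono) simp

lemma tree_rel_iff: "(v, w) \<in> tree_rel V E g \<longleftrightarrow> v \<in> V \<and> w \<in> V \<and> g v = g w \<and> w \<in> component (g v) v"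
  unfolding tree_rel_def using nonneg by auto

lemma equiv_tree_rel: "equiv V (tree_rel V E g)"
proof (rule equivI)
  show "tree_rel V E g \<subseteq> V \<times> V" by (auto simp: tree_rel_iff)
  show "refl_on V (tree_rel V E g)"
    by (auto simp: tree_rel_iff refl_on_def sublevel_component_refl)
  show "sym (tree_rel V E g)"
    by (rule symI) (auto simp: tree_rel_iff intro: sublevel_component_sym)
  show "trans (tree_rel V E g)"
    unfolding trans_def tree_rel_iff by (metis sublevel_component_trans)
qed

lemma quot_eq_iff:
  "v \<in> V \<Longrightarrow> w \<in> V \<Longrightarrow> quot v = quot w \<longleftrightarrow> g v = g w \<and> w \<in> component (g v) v"
  unfolding tree_quot_def by (simp add: eq_equiv_class_iff[OF equiv_tree_rel] tree_rel_iff)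

lemma tree_points_eq: "tree_points V E g = quot ` V"
  unfolding tree_points_def quotient_def tree_quot_def by auto

lemma tree_fun_quot: "v \<in> V \<Longrightarrow> tree_fun g (quot v) = g v"
proof -
  assume v: "v \<in> V"
  then have "v \<in> quot v" by (simp add: tree_quot_def tree_rel_iff sublevel_component_refl)
  then have "g ` quot v = {g v}" by (auto simp: tree_quot_def tree_rel_iff)
  then show ?thesis by (simp add: tree_fun_def)
qed

text \<open>Vertices of one class have the same value and the same component at that value, so the
  choice of representatives in \<open>tree_le\<close> is immaterial. Inclusion of components then
  reduces to membership of \<open>v\<close>, because components grow with the level.\<close>

lemma tree_le_quot_iff:
  assumes v: "v \<in> V" and w: "w \<in> V"
  shows "tree_le V E g (quot v) (quot w) \<longleftrightarrow> v \<in> component (g w) w"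
proof
  assume "tree_le V E g (quot v) (quot w)"
  then obtain v' w' where *: "v' \<in> V" "w' \<in> V" "quot v = quot v'" "quot w = quot w'"
      "component (g v') v' \<subseteq> component (g w') w'"
    unfolding tree_le_def by blast
  have "v \<in> component (g v') v'" using *(3) quot_eq_iff[OF *(1) v] by metis
  then have "v \<in> component (g w) w'" using * quot_eq_iff[OF w *(2)] by auto
  moreover have "w' \<in> component (g w) w" using *(4) quot_eq_iff[OF w *(2)] by metis
  ultimately show "v \<in> component (g w) w" using sublevel_component_trans by metis
next
  assume *: "v \<in> component (g w) w"
  then have "g v \<le> g w" by (simp add: sublevel_component_iff sublevel_def)
  then have "component (g v) v \<subseteq> component (g w) w"
    using * by (meson component_mono sublevel_component_trans subsetI)
  then show "tree_le V E g (quot v) (quot w)" unfolding tree_le_def using v w by blast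
qed

section \<open>Merge heights and the tree distance\<close>

definition common_upper :: "'a \<Rightarrow> 'a \<Rightarrow> 'a set" where
  "common_upper v w = {z \<in> V. v \<in> component (g z) z \<and> w \<in> component (g z) z}"

text \<open>The level \<open>m(v, w)\<close> of the overview, written over common ancestors because
  \<open>tree_dist\<close> takes its infimum over these; \<open>height_le_iff\<close> gives the
  description by components.\<close>

definition height :: "'a \<Rightarrow> 'a \<Rightarrow> real" where
  "height v w = Min (g ` common_upper v w)"

lemma finite_common_upper: "finite (common_upper v w)"
  unfolding common_upper_def using finite_V by simp

text \<open>Lowering the level from \<open>t\<close> to \<open>g z\<close> removes no vertex of the
  component when \<open>z\<close> is its highest vertex, so the component of \<open>z\<close> at its
  own level still contains \<open>v\<close> and \<open>w\<close>.\<close>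

lemma top_in_common_upper:
  assumes z: "z \<in> component t v" and max: "\<And>u. u \<in> component t v \<Longrightarrow> g u \<le> g z" and w: "w \<in> component t v"
  shows "z \<in> common_upper v w"
proof -
  have "z \<in> component (g z) v" "w \<in> component (g z) v"
    by (rule sublevel_component_subset[OF z max] sublevel_component_subset[OF w max], assumption)+
  then have "v \<in> component (g z) z" "w \<in> component (g z) z" "z \<in> V"
    by (meson sublevel_component_sym sublevel_component_trans)+
      (use z in \<open>auto simp: sublevel_component_iff sublevel_def\<close>)
  then show ?thesis unfolding common_upper_def by simp
qed

lemma common_upper_if_component:
  assumes "w \<in> component t v"
  shows "\<exists>z\<in>common_upper v w. g z \<le> t"
proof -
  have "finite (component t v)"
    by (rule finite_subset[OF _ finite_V]) (auto simp: sublevel_component_def sublevel_def)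
  then have "Max (g ` component t v) \<in> g ` component t v" using assms by (intro Max_in) auto
  then obtain z where z: "z \<in> component t v" "g z = Max (g ` component t v)" by auto
  then have "\<And>u. u \<in> component t v \<Longrightarrow> g u \<le> g z" using \<open>finite (component t v)\<close> by simp
  from top_in_common_upper[OF z(1) this assms] z(1) show ?thesis
    by (auto simp: sublevel_component_def sublevel_def)
qed

lemma common_upper_nonempty:
  assumes "v \<in> V" "w \<in> V"
  shows "common_upper v w \<noteq> {}"
proof -
  \<comment> \<open>At the maximal value the sublevel graph is the whole connected graph.\<close>
  have "sublevel V g (Max (g ` V)) = V" using finite_V by (auto simp: sublevel_def)
  then have "w \<in> component (Max (g ` V)) v"
    using connected[OF assms] assms by (simp add: sublevel_component_iff)
  then show ?thesis using common_upper_if_component by blast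
qed

text \<open>A common ancestor of value at most \<open>t\<close> joins \<open>v\<close> and
  \<open>w\<close> at level \<open>t\<close>; conversely, a highest vertex of their component at
  level \<open>t\<close> is such an ancestor. The later properties of \<open>height\<close> all rest
  on this equivalence.\<close>

lemma height_le_iff:
  assumes "v \<in> V" "w \<in> V"
  shows "height v w \<le> t \<longleftrightarrow> w \<in> component t v"
proof -
  have "height v w \<le> t \<longleftrightarrow> (\<exists>z\<in>common_upper v w. g z \<le> t)"
    unfolding height_def using finite_common_upper common_upper_nonempty[OF assms]
    by (subst Min_le_iff) auto
  moreover have "w \<in> component t v" if "z \<in> common_upper v w" "g z \<le> t" for z
    using that unfolding common_upper_def
    by (metis (no_types, lifting) component_mono mem_Collect_eq sublevel_component_sym
        sublevel_component_trans)
  ultimately show ?thesis using common_upper_if_component by blast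
qed

lemma component_height: "v \<in> V \<Longrightarrow> w \<in> V \<Longrightarrow> w \<in> component (height v w) v"
  using height_le_iff by blast

lemma height_ge: "v \<in> V \<Longrightarrow> w \<in> V \<Longrightarrow> max (g v) (g w) \<le> height v w"
  using component_height[of v w] by (auto simp: sublevel_component_iff sublevel_def)

lemma height_commute: "v \<in> V \<Longrightarrow> w \<in> V \<Longrightarrow> height v w = height w v"
  by (meson antisym component_height height_le_iff sublevel_component_sym)

lemma height_self: "v \<in> V \<Longrightarrow> height v v = g v"
  using height_ge[of v v] height_le_iff[of v v "g v"] by (simp add: sublevel_component_refl)

text \<open>Paths from \<open>u\<close> to \<open>v\<close> and from \<open>v\<close> to
  \<open>w\<close> concatenate at the larger of their two levels.\<close>

lemma height_ultra:
  assumes "u \<in> V" "v \<in> V" "w \<in> V"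
  shows "height u w \<le> max (height u v) (height v w)"
  unfolding height_le_iff[OF assms(1,3)]
  by (rule sublevel_component_trans[of v]; rule component_mono[OF component_height]; use assms in simp)

lemma tree_upper_quot:
  assumes "v \<in> V" "w \<in> V"
  shows "tree_upper V E g (quot v) (quot w) = quot ` common_upper v w"
  unfolding tree_upper_def tree_points_eq common_upper_def
  using assms by (auto simp: tree_le_quot_iff)

text \<open>The maximum of \<open>g z - g v\<close> and \<open>g z - g w\<close> is
  \<open>g z - min (g v) (g w)\<close>, so only \<open>g z\<close> remains to be minimised. The set
  of ancestors is finite and nonempty, hence the real infimum is a genuine minimum.\<close>

lemma tree_dist_quot:
  assumes "v \<in> V" "w \<in> V"
  shows "tree_dist V E g (quot v) (quot w) = height v w - min (g v) (g w)"
proof -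
  have "tree_dist V E g (quot v) (quot w) = (INF z\<in>common_upper v w. g z - min (g v) (g w))"
    unfolding tree_dist_def tree_upper_quot[OF assms] image_image
    using assms by (intro INF_cong) (auto simp: common_upper_def tree_fun_quot)
  also have "\<dots> = height v w - min (g v) (g w)"
  proof (rule cInf_eq_minimum)
    have "height v w \<in> g ` common_upper v w"
      unfolding height_def using finite_common_upper common_upper_nonempty[OF assms]
      by (intro Min_in) auto
    then show "height v w - min (g v) (g w) \<in> (\<lambda>z. g z - min (g v) (g w)) ` common_upper v w"
      by auto
  next
    fix y assume "y \<in> (\<lambda>z. g z - min (g v) (g w)) ` common_upper v w"
    then show "height v w - min (g v) (g w) \<le> y"
      unfolding height_def using finite_common_upper by auto
  qed
  finally show ?thesis .
qed

lemma pseudo_metric_on_tree_dist: "pseudo_metric_on (tree_points V E g) (tree_dist V E g)"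
proof -
  have nonneg_dist: "0 \<le> tree_dist V E g (quot v) (quot w)" if "v \<in> V" "w \<in> V" for v w
    using height_ge[OF that] by (simp add: tree_dist_quot that min_le_iff_disj)
  \<comment> \<open>If \<open>height u v\<close> dominates \<open>height u w\<close>, what remains
    is \<open>min (g u) (g v) + min (g v) (g w) \<le> height v w + min (g u) (g w)\<close>, which
    follows from \<open>height v w \<ge> max (g v) (g w)\<close>. The other case is
    symmetric.\<close>
  have tri: "tree_dist V E g (quot u) (quot w)
      \<le> tree_dist V E g (quot u) (quot v) + tree_dist V E g (quot v) (quot w)"
    if "u \<in> V" "v \<in> V" "w \<in> V" for u v w
    using height_ultra[OF that] height_ge[OF that(1,2)] height_ge[OF that(2,3)]
    by (simp add: tree_dist_quot that) linarith
  show ?thesis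
    unfolding pseudo_metric_on_def tree_points_eq
    using nonneg_dist tri
    by (auto simp: tree_dist_quot height_self height_commute min.commute)
qed

text \<open>Different values separate \<open>height\<close> from the smaller value; with equal
  values, different classes are not yet joined at that level. Positivity makes the finite tree
  discrete, so that all its subsets are Borel.\<close>

lemma tree_dist_pos:
  assumes "a \<in> tree_points V E g" "b \<in> tree_points V E g" "a \<noteq> b"
  shows "0 < tree_dist V E g a b"
proof -
  obtain v w where vw: "v \<in> V" "w \<in> V" "a = quot v" "b = quot w"
    using assms tree_points_eq by auto
  have "height v w > g v \<or> g v \<noteq> g w"
    using assms(3) vw quot_eq_iff[OF vw(1,2)] height_le_iff[OF vw(1,2), of "g v"] by force
  then show ?thesis
    using height_ge[OF vw(1,2)] unfolding vw(3,4) tree_dist_quot[OF vw(1,2)] by auto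
qed

end

section \<open>Stability under perturbation of the function\<close>

lemma height_le_add:
  assumes "merge_tree_graph V E g" "merge_tree_graph V E g'"
    and close: "\<And>v. v \<in> V \<Longrightarrow> \<bar>g v - g' v\<bar> \<le> \<epsilon>" and v: "v \<in> V" and w: "w \<in> V"
  shows "merge_tree_graph.height V E g v w \<le> merge_tree_graph.height V E g' v w + \<epsilon>"
proof -
  interpret G: merge_tree_graph V E g by fact
  interpret G': merge_tree_graph V E g' by fact
  \<comment> \<open>The sublevel set of \<open>g'\<close> at a level lies in that of
    \<open>g\<close> at the level raised by \<epsilon>, so a connecting path survives.\<close>
  have "w \<in> G.component (G'.height v w + \<epsilon>) v"
    using G'.component_height[OF v w] by (rule sublevel_component_mono) (use close in fastforce)
  then show ?thesis by (simp add: G.height_le_iff v w)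
qed

lemma tree_dist_distortion:
  assumes "merge_tree_graph V E g" "merge_tree_graph V E g'"
    and close: "\<And>v. v \<in> V \<Longrightarrow> \<bar>g v - g' v\<bar> \<le> \<epsilon>" and v: "v \<in> V" and w: "w \<in> V"
  shows "\<bar>tree_dist V E g (tree_quot V E g v) (tree_quot V E g w)
      - tree_dist V E g' (tree_quot V E g' v) (tree_quot V E g' w)\<bar> \<le> 2 * \<epsilon>"
proof -
  have close': "\<And>v. v \<in> V \<Longrightarrow> \<bar>g' v - g v\<bar> \<le> \<epsilon>" using close by (simp add: abs_minus_commute)
  show ?thesis
    unfolding merge_tree_graph.tree_dist_quot[OF assms(1) v w]
      merge_tree_graph.tree_dist_quot[OF assms(2) v w]
    using height_le_add[OF assms] height_le_add[OF assms(2,1) close' v w] close[OF v] close[OF w]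
    by linarith
qed

subsection \<open>Coupling two merge trees\<close>

lemma space_pm_borel: "space (pm_borel Z d) = Z"
  by (simp add: pm_borel_def space_measure_of_conv)

lemma sets_pm_borel_discrete:
  assumes "finite Z" and pos: "\<And>x y. x \<in> Z \<Longrightarrow> y \<in> Z \<Longrightarrow> x \<noteq> y \<Longrightarrow> 0 < d x y"
  shows "sets (pm_borel Z d) = Pow Z"
proof -
  have "pm_open Z d U" if "U \<subseteq> Z" for U
    unfolding pm_open_def
  proof (intro conjI ballI)
    fix x assume x: "x \<in> U"
    \<comment> \<open>A radius below which the ball around \<open>x\<close> is just
      \<open>{x}\<close>; the inserted 1 keeps the minimum defined when
      \<open>Z = {x}\<close>.\<close>
    define r where "r = Min (insert 1 (d x ` (Z - {x})))"
    have "r > 0" unfolding r_def using assms x that by (subst Min_gr_iff) auto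
    moreover have "y = x" if "y \<in> Z" "d x y < r" for y
    proof (rule ccontr)
      assume "y \<noteq> x"
      then have "r \<le> d x y" unfolding r_def using that assms(1) by (intro Min_le) auto
      with that show False by simp
    qed
    ultimately show "\<exists>r>0. {y \<in> Z. d x y < r} \<subseteq> U" using x by blast
  qed fact
  then have opens: "{U. pm_open Z d U} = Pow Z" by (auto simp: pm_open_def)
  have "sets (pm_borel Z d) = sigma_sets Z (Pow Z)"
    unfolding pm_borel_def opens by (simp add: sets_measure_of)
  then show ?thesis by (simp add: sigma_algebra.sigma_sets_eq[OF sigma_algebra_Pow])
qed

lemma ennreal_root_le:
  assumes "p > 0" "c \<ge> 0" "x \<le> ennreal (c powr p)"
  shows "ennreal_root p x \<le> ennreal c"
proof -
  have "x \<noteq> \<top>" using assms(3) by (auto simp: top_unique)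
  have "enn2real x \<le> c powr p" using assms(3) by (simp add: enn2real_leI)
  then have "enn2real x powr (1 / p) \<le> (c powr p) powr (1 / p)"
    using assms(1) by (intro powr_mono2) auto
  also have "\<dots> = c" using assms(1,2) by (simp add: powr_powr)
  finally show ?thesis using \<open>x \<noteq> \<top>\<close> by (simp add: ennreal_root_def ennreal_leI)
qed

lemma (in prob_space) ennreal_root_nn_integral_le:
  assumes "p > 0" "c \<ge> 0" "\<And>z. z \<in> space M \<Longrightarrow> 0 \<le> f z \<and> f z \<le> c"
  shows "ennreal_root p (\<integral>\<^sup>+ z. ennreal (f z powr p) \<partial>M) \<le> ennreal c"
proof (rule ennreal_root_le[OF assms(1,2)])
  have "(\<integral>\<^sup>+ z. ennreal (f z powr p) \<partial>M) \<le> (\<integral>\<^sup>+ z. ennreal (c powr p) \<partial>M)"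
    using assms by (intro nn_integral_mono ennreal_leI powr_mono2) auto
  then show "(\<integral>\<^sup>+ z. ennreal (f z powr p) \<partial>M) \<le> ennreal (c powr p)"
    by (simp add: emeasure_space_1)
qed

lemma KS_dist_le:
  assumes "h \<in> couplings F F'" "D \<in> metric_couplings F F'"
    and "ennreal_root p (\<integral>\<^sup>+ z. ennreal (D (Inl (fst z)) (Inr (snd z)) powr p) \<partial>h) \<le> c"
    and "ennreal_root p (\<integral>\<^sup>+ z. ennreal (\<bar>func F (fst z) - func F' (snd z)\<bar> powr p) \<partial>h) \<le> c"
  shows "KS_dist p F F' \<le> c"
  unfolding KS_dist_def
  by (rule INF_lower2[where i = "(h, D)"]) (use assms in auto)

text \<open>Both integrands are at most \<epsilon> at every matched pair, not merely on average, so
  total mass one gives a bound that does not depend on \<open>p\<close>.\<close>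

lemma KS_dist_merge_tree_le:
  assumes G: "merge_tree_graph V E g" and G': "merge_tree_graph V E g'"
    and close: "\<And>v. v \<in> V \<Longrightarrow> \<bar>g v - g' v\<bar> \<le> \<epsilon>"
    and prob: "prob_space (point_measure V (\<lambda>v. ennreal (\<omega> v)))" and p: "p > 0"
  shows "KS_dist p (merge_tree V E g \<omega>) (merge_tree V E g' \<omega>) \<le> ennreal \<epsilon>"
proof -
  interpret G: merge_tree_graph V E g by fact
  interpret G': merge_tree_graph V E g' by fact
  define M where "M = point_measure V (\<lambda>v. ennreal (\<omega> v))"
  interpret M: prob_space M unfolding M_def by fact
  have [simp]: "space M = V" "sets M = Pow V"
    by (simp_all add: M_def space_point_measure sets_point_measure)
  \<comment> \<open>Total mass one yields a vertex: it makes \<epsilon> nonnegative through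
    \<open>close\<close>, and the index set of the gluing nonempty.\<close>
  have V: "V \<noteq> {}" using M.not_empty by simp
  then have \<epsilon>: "0 \<le> \<epsilon>" using close by force
  let ?F = "merge_tree V E g \<omega>" and ?F' = "merge_tree V E g' \<omega>"
  let ?T = "tree_points V E g" and ?T' = "tree_points V E g'"
  let ?d = "tree_dist V E g" and ?d' = "tree_dist V E g'"
  define B where "B = pm_borel (?T \<times> ?T') (\<lambda>a b. max (?d (fst a) (fst b)) (?d' (snd a) (snd b)))"
  define e where "e v = (G.quot v, G'.quot v)" for v
  define h where "h = distr M B e"
  have fin: "finite ?T" "finite ?T'"
    by (simp_all add: G.tree_points_eq G'.tree_points_eq G.finite_V)
  have quot: "G.quot v \<in> ?T" "G'.quot v \<in> ?T'" if "v \<in> V" for v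
    using that by (auto simp: G.tree_points_eq G'.tree_points_eq)
  have sT: "sets (pm_borel ?T ?d) = Pow ?T"
    using sets_pm_borel_discrete[OF fin(1), of ?d] G.tree_dist_pos by blast
  have sT': "sets (pm_borel ?T' ?d') = Pow ?T'"
    using sets_pm_borel_discrete[OF fin(2), of ?d'] G'.tree_dist_pos by blast
  \<comment> \<open>The product is discrete too: the maximum of the two distances is positive as
    soon as one coordinate differs.\<close>
  have sB: "sets B = Pow (?T \<times> ?T')"
    unfolding B_def using fin
    by (intro sets_pm_borel_discrete)
      (auto simp: less_max_iff_disj intro: G.tree_dist_pos G'.tree_dist_pos)
  have spB: "space B = ?T \<times> ?T'" by (simp add: B_def space_pm_borel)
  have e: "e \<in> measurable M B"
    by (rule measurableI) (auto simp: spB e_def quot)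
  have fst: "fst \<in> measurable B (pm_borel ?T ?d)"
    by (rule measurableI) (auto simp: spB sB sT space_pm_borel)
  have snd: "snd \<in> measurable B (pm_borel ?T' ?d')"
    by (rule measurableI) (auto simp: spB sB sT' space_pm_borel)
  interpret h: prob_space h unfolding h_def by (rule M.prob_space_distr[OF e])
  \<comment> \<open>Composing \<open>e\<close> with a projection gives back a quotient map, whose
    push-forward is by definition the mass of that tree.\<close>
  have marginals: "distr h (pm_borel ?T ?d) fst = mass ?F" "distr h (pm_borel ?T' ?d') snd = mass ?F'"
    unfolding h_def distr_distr[OF fst e] distr_distr[OF snd e]
    by (simp_all add: merge_tree_def M_def comp_def e_def)
  have coupling: "h \<in> couplings ?F ?F'"
    using marginals h.prob_space_axioms
    by (simp add: couplings_def merge_tree_def h_def spB) (simp add: B_def)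
  define D where "D = glue ?d ?d' (cross_dist V G.quot G'.quot ?d ?d' \<epsilon>)"
  have "pseudo_metric_on (?T <+> ?T') D"
    unfolding D_def
    by (rule pseudo_metric_on_glue[OF G.pseudo_metric_on_tree_dist G'.pseudo_metric_on_tree_dist
          G.finite_V V _ _ \<epsilon> tree_dist_distortion[OF G G' close]]) (auto simp: quot)
  \<comment> \<open>\<open>D\<close> agrees with the tree distances on all points, in particular on
    the supports.\<close>
  then have metric: "D \<in> metric_couplings ?F ?F'"
    by (simp add: metric_couplings_def merge_tree_def D_def)
  have matched: "0 \<le> D (Inl (G.quot v)) (Inr (G'.quot v))" "D (Inl (G.quot v)) (Inr (G'.quot v)) \<le> \<epsilon>"
    if v: "v \<in> V" for v
  proof -
    show "0 \<le> D (Inl (G.quot v)) (Inr (G'.quot v))"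
      using pseudo_metric_onD(1)[OF \<open>pseudo_metric_on (?T <+> ?T') D\<close>] quot[OF v] by auto
    \<comment> \<open>Crossing at the bridge of \<open>v\<close> itself leaves end segments of
      length 0.\<close>
    have "D (Inl (G.quot v)) (Inr (G'.quot v))
        \<le> ?d (G.quot v) (G.quot v) + \<epsilon> + ?d' (G'.quot v) (G'.quot v)"
      unfolding D_def using cross_dist_le[OF G.finite_V v] by simp
    then show "D (Inl (G.quot v)) (Inr (G'.quot v)) \<le> \<epsilon>"
      by (simp add: G.tree_dist_quot G'.tree_dist_quot v G.height_self G'.height_self)
  qed
  have transfer: "(\<integral>\<^sup>+ z. f z \<partial>h) = (\<integral>\<^sup>+ v. f (e v) \<partial>M)" for f
    unfolding h_def
    by (rule nn_integral_distr[OF e], rule measurableI) (auto simp: sB spB)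
  show ?thesis
  proof (rule KS_dist_le[OF coupling metric])
    show "ennreal_root p (\<integral>\<^sup>+ z. ennreal (D (Inl (fst z)) (Inr (snd z)) powr p) \<partial>h) \<le> ennreal \<epsilon>"
      unfolding transfer
      by (rule M.ennreal_root_nn_integral_le[OF p \<epsilon>]) (simp add: e_def matched)
    show "ennreal_root p (\<integral>\<^sup>+ z. ennreal (\<bar>func ?F (fst z) - func ?F' (snd z)\<bar> powr p) \<partial>h)
        \<le> ennreal \<epsilon>"
      unfolding transfer
      by (rule M.ennreal_root_nn_integral_le[OF p \<epsilon>])
        (simp add: e_def merge_tree_def G.tree_fun_quot G'.tree_fun_quot close)
  qed
qed

subsection \<open>Combinatorial approximations\<close>

text \<open>The closed \<delta>-balls around the vertices reachable from \<open>v\<close>, and those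
  around the others, form two closed sets (finite unions) covering \<open>X\<close>. If both
  families were nonempty, connectedness would give a common point, hence centres at distance at most
  \<open>2 * \<delta>\<close> and an edge between a reachable and an unreachable vertex.\<close>

lemma approx_graph_connected:
  assumes "Metric_space X dX" and conn: "connected_space (Metric_space.mtopology X dX)"
    and fin: "finite V" and cov: "is_covering X dX \<delta> V" and \<delta>: "\<delta> > 0"
    and v: "v \<in> V" and w: "w \<in> V"
  shows "(v, w) \<in> {(a, b). a \<in> V \<and> b \<in> V \<and> {a, b} \<in> approx_edges dX \<delta> V}\<^sup>*"
proof (rule ccontr)
  interpret X: Metric_space X dX by fact
  let ?R = "{(a, b). a \<in> V \<and> b \<in> V \<and> {a, b} \<in> approx_edges dX \<delta> V}"
  assume nreach: "(v, w) \<notin> ?R\<^sup>*"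
  define A where "A = {u \<in> V. (v, u) \<in> ?R\<^sup>*}"
  define balls where "balls S = (\<Union>u\<in>S. X.mcball u \<delta>)" for S
  have VX: "V \<subseteq> X" using cov by (simp add: is_covering_def)
  have A: "A \<subseteq> V" "v \<in> A" "w \<in> V - A" using v w nreach by (auto simp: A_def)
  have centre: "u \<in> balls S" if "u \<in> S" "S \<subseteq> V" for u S
    using that VX \<delta> by (auto simp: balls_def intro!: bexI[of _ u] X.centre_in_mcball_iff[THEN iffD2])
  have closed: "closedin X.mtopology (balls S)" if "S \<subseteq> V" for S
    unfolding balls_def using finite_subset[OF that fin] by (intro closedin_Union) auto
  have cover: "topspace X.mtopology \<subseteq> balls A \<union> balls (V - A)"
  proof
    fix y assume "y \<in> topspace X.mtopology"
    then have y: "y \<in> X" by simp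
    then obtain u where u: "u \<in> V" "dX y u \<le> \<delta>" using cov by (auto simp: is_covering_def)
    then have "y \<in> X.mcball u \<delta>" using y VX by (auto simp: X.commute)
    then show "y \<in> balls A \<union> balls (V - A)" using u by (auto simp: balls_def)
  qed
  have disjoint: "balls A \<inter> balls (V - A) = {}"
  proof (rule equals0I)
    fix y assume "y \<in> balls A \<inter> balls (V - A)"
    then obtain a b where ab: "a \<in> A" "b \<in> V - A" "y \<in> X.mcball a \<delta>" "y \<in> X.mcball b \<delta>"
      by (auto simp: balls_def)
    then have "dX a b \<le> 3 * \<delta>"
      using X.triangle[of a y b] \<delta> by (auto simp: X.commute)
    then have "(a, b) \<in> ?R" using ab A(1) by (auto simp: approx_edges_def)
    then have "b \<in> A" using ab by (auto simp: A_def intro: rtrancl_into_rtrancl)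
    then show False using ab by simp
  qed
  have "v \<in> balls A" "w \<in> balls (V - A)"
    using centre[OF A(2,1)] centre[OF A(3) Diff_subset] .
  then have "balls A \<noteq> {}" "balls (V - A) \<noteq> {}" by auto
  with conn closed[OF A(1)] closed[OF Diff_subset] cover disjoint show False
    unfolding connected_space_closedin by blast
qed

text \<open>The fibres of the assignment of indices to vertices partition \<open>{1..n}\<close>, so
  their cardinalities add up to \<open>n\<close>.\<close>

lemma prob_space_approx_weight:
  assumes "finite V" "n \<ge> 1" "\<forall>i\<in>{1..n}. \<phi> (x i) \<in> V"
  shows "prob_space (point_measure V (\<lambda>v. ennreal (approx_weight n x \<phi> v)))"
proof (rule prob_spaceI)
  have "(\<Sum>v\<in>V. card {i \<in> {1..n}. \<phi> (x i) = v}) = card (\<Union>v\<in>V. {i \<in> {1..n}. \<phi> (x i) = v})"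
    using assms(1) by (intro card_UN_disjoint[symmetric]) auto
  also have "(\<Union>v\<in>V. {i \<in> {1..n}. \<phi> (x i) = v}) = {1..n}" using assms(3) by auto
  finally have "(\<Sum>v\<in>V. real (card {i \<in> {1..n}. \<phi> (x i) = v})) = real n"
    by (simp flip: of_nat_sum)
  then have "(\<Sum>v\<in>V. approx_weight n x \<phi> v) = 1"
    using assms(2) by (simp add: approx_weight_def flip: sum_divide_distrib)
  moreover have "(\<Sum>v\<in>V. ennreal (approx_weight n x \<phi> v)) = ennreal (\<Sum>v\<in>V. approx_weight n x \<phi> v)"
    by (rule sum_ennreal) (simp add: approx_weight_def)
  ultimately show "emeasure (point_measure V (\<lambda>v. ennreal (approx_weight n x \<phi> v)))
      (space (point_measure V (\<lambda>v. ennreal (approx_weight n x \<phi> v)))) = 1"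
    using assms(1) by (simp add: space_point_measure emeasure_point_measure_finite)
qed

text \<open>Rounding down loses \<epsilon> times a fractional part, which lies in [0, 1).\<close>

lemma quantize_close:
  assumes "\<epsilon> > 0"
  shows "\<bar>g v - quantize \<epsilon> g v\<bar> \<le> \<epsilon>"
proof -
  have "g v - quantize \<epsilon> g v = \<epsilon> * frac (g v / \<epsilon>)"
    using assms by (simp add: quantize_def frac_def algebra_simps)
  then show ?thesis
    using assms frac_ge_0[of "g v / \<epsilon>"] frac_lt_1[of "g v / \<epsilon>"] by (simp add: abs_mult)
qed

theorem theorem6p4:
  fixes X :: "'a set" and dX \<theta> :: "'a \<Rightarrow> 'a \<Rightarrow> real"
    and p \<delta> \<epsilon> :: real and V :: "'a set"
    and n :: nat and x :: "nat \<Rightarrow> 'a" and \<phi> :: "'a \<Rightarrow> 'a"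
    and E :: "'a set set" and \<omega> \<sigma> :: "'a \<Rightarrow> real"
  assumes "Metric_space X dX"
    and "compact_space (Metric_space.mtopology X dX)"
    and "connected_space (Metric_space.mtopology X dX)"
    and "locally_path_connected_space (Metric_space.mtopology X dX)"
    and "p \<ge> 1"
    and "pseudo_metric_on X \<theta>" and "admissible X dX \<theta>"
    and "\<delta> > 0" and "finite V" and "is_covering X dX \<delta> V"
    and "n \<ge> 1" and "\<forall>i\<in>{1..n}. x i \<in> X"
    and "\<forall>i\<in>{1..n}. \<phi> (x i) \<in> V \<and> dX (x i) (\<phi> (x i)) \<le> \<delta>"
    and "E = approx_edges dX \<delta> V"
    and "\<omega> = approx_weight n x \<phi>"
    and "\<sigma> = deviation p \<theta> V \<omega>"
    and "\<epsilon> > 0"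
  shows "KS_dist p (merge_tree V E \<sigma> \<omega>) (merge_tree V E (quantize \<epsilon> \<sigma>) \<omega>) \<le> ennreal \<epsilon>"
proof (rule KS_dist_merge_tree_le)
  have connected: "(v, w) \<in> {(a, b). a \<in> V \<and> b \<in> V \<and> {a, b} \<in> E}\<^sup>*" if "v \<in> V" "w \<in> V" for v w
    using approx_graph_connected[OF assms(1,3,9,10,8) that] assms(14) by simp
  \<comment> \<open>The outer \<open>powr\<close> is nonnegative for every real base.\<close>
  have \<sigma>: "0 \<le> \<sigma> v" for v
    by (simp add: assms(16) deviation_def)
  show "merge_tree_graph V E \<sigma>"
    using assms(9) connected \<sigma> by unfold_locales
  show "merge_tree_graph V E (quantize \<epsilon> \<sigma>)"
    using assms(9) connected \<sigma> assms(17)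
    by unfold_locales (auto simp: quantize_def intro!: mult_nonneg_nonneg)
  show "\<bar>\<sigma> v - quantize \<epsilon> \<sigma> v\<bar> \<le> \<epsilon>" for v
    by (rule quantize_close[OF assms(17)])
  show "prob_space (point_measure V (\<lambda>v. ennreal (\<omega> v)))"
    unfolding assms(15) using assms(9,11,13) by (intro prob_space_approx_weight) auto
  show "p > 0" using assms(5) by simp
qed

end
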